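(* For a two-dimensional convex body $K \subseteq \mathbb{R}^2$, the following conditions (i)--(v) are equivalent. (i) $i(K,R(K)) < \infty$. (ii) $\sup_{0 < \varrho < R(K)} c(K,\varrho) < \infty$. (iii) There are a finite set $\{x_1,\dots,x_k\} \subseteq K \cap \mathrm{bd}(B(c_K,R(K)))$ and $\delta > 0$ such that $K \cap B^o(c_K,\delta) \subseteq \bigcup_{i=1}^k (K + (c_K - x_i))$. (iv) There are a finite set $\{x_1,\dots,x_k\} \subseteq K \cap \mathrm{bd}(B(c_K,R(K)))$ and $\delta > 0$ such that $B^o(c_K,\delta) \subseteq \bigcup_{i=1}^k (K + (c_K - x_i))$. (v) The set $\bigcup_{x \in K \cap \mathrm{bd}(B(c_K,R(K)))} (K + (c_K - x))$ covers a neighborhood of $c_K$ in $K$, i.e., $$\exists \delta > 0 \ \left( K \cap B^o(c_K,\delta) \subseteq \bigcup_{x \in K \cap \mathrm{bd}(B(c_K,R(K)))} (K + (c_K - x)) \right).$$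
   Context: A convex body $K \subseteq \mathbb{R}^n$ is a compact convex set with nonempty interior (here $n=2$); $\|\cdot\|$ is the Euclidean norm, $S^{n-1} = \{x \in \mathbb{R}^n : \|x\| = 1\}$, $\mathrm{bd}$ denotes the boundary, and $B(x_0,r) = \{x : \|x - x_0\| \le r\}$, $B^o(x_0,r) = \{x : \|x-x_0\| < r\}$ are closed and open balls. The circumball $B(c_K,R(K))$ of $K$ is the unique closed ball of minimal radius containing $K$; $c_K$ is the circumcenter and $R(K)$ the circumradius of $K$. For $\varepsilon > 0$ define $$c(K,\varepsilon) = \min\{m : \exists r_1,\dots,r_m \in S^{n-1} \ \forall x \in K \ \exists i \ (x + \varepsilon r_i \in \mathrm{int}(K))\},$$ $$i(K,\varepsilon) = \min\{m : \exists r_1,\dots,r_m \in S^{n-1} \ \forall x \in K \ \exists i \ (x + \varepsilon r_i \in K)\},$$ where in each case the value is $\infty$ if no such $m$ exists. *)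

theory Defs
  imports "HOL-Analysis.Analysis"
begin

definition convex_body :: "'a::euclidean_space set \<Rightarrow> bool" where
  "convex_body K \<longleftrightarrow> compact K \<and> convex K \<and> interior K \<noteq> {}"

definition is_circumball :: "'a::euclidean_space set \<Rightarrow> 'a \<Rightarrow> real \<Rightarrow> bool" where
  "is_circumball K c r \<longleftrightarrow>
     K \<subseteq> cball c r \<and> (\<forall>c' r'. K \<subseteq> cball c' r' \<longrightarrow> r \<le> r')"

text \<open>Both descriptions are proper for nonempty compact sets, see
  \<open>circumball_unique\<close> and \<open>is_circumball_circumcenter\<close> below.\<close>

definition circumcenter :: "'a::euclidean_space set \<Rightarrow> 'a" where
  "circumcenter K = (THE c. \<exists>r. is_circumball K c r)"

definition circumradius :: "'a::euclidean_space set \<Rightarrow> real" where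
  "circumradius K = (THE r. \<exists>c. is_circumball K c r)"

text \<open>In \<^typ>\<open>enat\<close> the infimum of a nonempty set is its minimum, and the infimum of
  the empty set is \<open>\<infinity>\<close>. The directions \<open>r\<^sub>1, \<dots>, r\<^sub>m\<close> are indexed from \<open>0\<close> and need
  not be distinct.\<close>

definition c_num :: "'a::euclidean_space set \<Rightarrow> real \<Rightarrow> enat" where
  "c_num K \<epsilon> = Inf {enat m | m. \<exists>r :: nat \<Rightarrow> 'a. (\<forall>i<m. r i \<in> sphere 0 1) \<and>
     (\<forall>x\<in>K. \<exists>i<m. x + \<epsilon> *\<^sub>R r i \<in> interior K)}"

definition i_num :: "'a::euclidean_space set \<Rightarrow> real \<Rightarrow> enat" where
  "i_num K \<epsilon> = Inf {enat m | m. \<exists>r :: nat \<Rightarrow> 'a. (\<forall>i<m. r i \<in> sphere 0 1) \<and>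
     (\<forall>x\<in>K. \<exists>i<m. x + \<epsilon> *\<^sub>R r i \<in> K)}"

lemma circumball_unique:
  fixes K :: "'a::euclidean_space set"
  assumes "K \<noteq> {}" and 1: "is_circumball K c r" and 2: "is_circumball K c' r'"
  shows "c = c'" "r = r'"
proof -
  show r: "r = r'"
    using 1 2 unfolding is_circumball_def by (meson order_antisym)
  define m where "m = (1/2) *\<^sub>R (c + c')"
  define s where "s = sqrt (r\<^sup>2 - (norm (c - c'))\<^sup>2 / 4)"
  have par: "(norm (m - x))\<^sup>2 = (norm (c - x))\<^sup>2 / 2 + (norm (c' - x))\<^sup>2 / 2 - (norm (c - c'))\<^sup>2 / 4"
    for x
    unfolding m_def power2_norm_eq_inner
    by (simp add: inner_add inner_diff inner_commute field_simps)
  have bd: "norm (c - x) \<le> r" "norm (c' - x) \<le> r" if "x \<in> K" for x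
    using 1 2 r that unfolding is_circumball_def by (auto simp: dist_norm)
  have sq: "(norm (c - x))\<^sup>2 \<le> r\<^sup>2" "(norm (c' - x))\<^sup>2 \<le> r\<^sup>2" if "x \<in> K" for x
    using bd[OF that] by (auto intro: power_mono)
  obtain x0 where "x0 \<in> K" using \<open>K \<noteq> {}\<close> by auto
  have "0 \<le> r" using bd(1)[OF \<open>x0 \<in> K\<close>] norm_ge_zero order_trans by blast
  have le: "(norm (m - x))\<^sup>2 \<le> r\<^sup>2 - (norm (c - c'))\<^sup>2 / 4" if "x \<in> K" for x
    using par[of x] sq[OF that] by linarith
  have "K \<subseteq> cball m s"
    using real_le_rsqrt[OF le] by (auto simp: dist_norm s_def)
  then have "r \<le> s" using 1 unfolding is_circumball_def by blast
  then have "r\<^sup>2 \<le> s\<^sup>2" using \<open>0 \<le> r\<close> by (intro power_mono)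
  moreover have "0 \<le> r\<^sup>2 - (norm (c - c'))\<^sup>2 / 4"
    using le[OF \<open>x0 \<in> K\<close>] zero_le_power2 order_trans by blast
  then have "s\<^sup>2 = r\<^sup>2 - (norm (c - c'))\<^sup>2 / 4" by (simp add: s_def)
  ultimately have "(norm (c - c'))\<^sup>2 \<le> 0" by linarith
  then show "c = c'" by simp
qed

lemma circumball_exists:
  fixes K :: "'a::euclidean_space set"
  assumes "compact K" and "K \<noteq> {}"
  shows "\<exists>c r. is_circumball K c r"
proof -
  define S where "S = {r. \<exists>c. K \<subseteq> cball c r}"
  obtain x0 where x0: "x0 \<in> K" using assms by auto
  obtain a e where "K \<subseteq> cball a e"
    using compact_imp_bounded[OF \<open>compact K\<close>] bounded_subset_cball by blast
  then have ne: "S \<noteq> {}" unfolding S_def by blast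
  have nonneg: "0 \<le> r" if "r \<in> S" for r
  proof -
    from that obtain c where "K \<subseteq> cball c r" unfolding S_def by blast
    then have "dist c x0 \<le> r" using x0 by auto
    then show ?thesis using zero_le_dist order_trans by blast
  qed
  then have bdd: "bdd_below S" by (auto simp: bdd_below_def)
  define R where "R = Inf S"
  have "\<exists>c. K \<subseteq> cball c (R + 1 / real (Suc n))" for n
  proof -
    have "Inf S < R + 1 / real (Suc n)" by (simp add: R_def)
    then obtain r c where "r < R + 1 / real (Suc n)" "K \<subseteq> cball c r"
      using cInf_lessD[OF ne] unfolding S_def by blast
    then show ?thesis using subset_cball[of r "R + 1 / real (Suc n)" c] by fastforce
  qed
  then obtain c where c: "\<And>n. K \<subseteq> cball (c n) (R + 1 / real (Suc n))" by metis
  have "c n \<in> cball x0 (R + 1)" for n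
  proof -
    have "dist (c n) x0 \<le> R + 1 / real (Suc n)" using c[of n] x0 by auto
    also have "\<dots> \<le> R + 1" by simp
    finally show ?thesis by (simp add: dist_commute)
  qed
  then obtain l f where f: "strict_mono f" and l: "(c \<circ> f) \<longlonglongrightarrow> l"
    using compact_cball[of x0 "R + 1"] unfolding compact_def by metis
  have "dist l x \<le> R" if "x \<in> K" for x
  proof (rule LIMSEQ_le)
    show "(\<lambda>n. dist ((c \<circ> f) n) x) \<longlonglongrightarrow> dist l x"
      by (intro tendsto_intros l)
    have "(\<lambda>n. R + 1 / real (Suc n)) \<longlonglongrightarrow> R + 0"
      using LIMSEQ_inverse_real_of_nat by (intro tendsto_intros) (simp add: inverse_eq_divide)
    then show "(\<lambda>n. R + 1 / real (Suc (f n))) \<longlonglongrightarrow> R"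
      using LIMSEQ_subseq_LIMSEQ[OF _ f] by (fastforce simp: o_def)
    show "\<exists>N. \<forall>n\<ge>N. dist ((c \<circ> f) n) x \<le> R + 1 / real (Suc (f n))"
      using c that by fastforce
  qed
  then have "K \<subseteq> cball l R" by auto
  moreover have "R \<le> r'" if "K \<subseteq> cball c' r'" for c' r'
    unfolding R_def using that bdd by (intro cInf_lower) (auto simp: S_def)
  ultimately show ?thesis unfolding is_circumball_def by blast
qed

lemma is_circumball_circumcenter:
  fixes K :: "'a::euclidean_space set"
  assumes "compact K" and "K \<noteq> {}"
  shows "is_circumball K (circumcenter K) (circumradius K)"
proof -
  obtain c r where cr: "is_circumball K c r" using circumball_exists[OF assms] by blast
  have "circumcenter K = c" unfolding circumcenter_def
    using cr circumball_unique[OF \<open>K \<noteq> {}\<close>] by (intro the_equality) blast+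
  moreover have "circumradius K = r" unfolding circumradius_def
    using cr circumball_unique[OF \<open>K \<noteq> {}\<close>] by (intro the_equality) blast+
  ultimately show ?thesis using cr by simp
qed

end

theory Submission
  imports Defs
begin

text \<open>
Write \<open>c\<close> and \<open>R\<close> for circumcenter and circumradius, and call the points of
\<open>K\<close> at distance \<open>R\<close> from \<open>c\<close> the touching points. A unit vector \<open>r\<close> with
\<open>c + R r \<in> K\<close> is the same thing as a touching point \<open>x = c + R r\<close>, and moving \<open>z\<close> by
\<open>R r\<close> into \<open>K\<close> means that \<open>z\<close> lies in the translate \<open>K + (c - x)\<close>. Directions and
translates thus say the same near \<open>c\<close>; everywhere else finitely many directions suffice by
compactness, because no sphere of radius \<open>0 < \<rho> \<le> R\<close> around a point of \<open>K\<close> misses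
the interior of \<open>K\<close>, except when the point is \<open>c\<close> and \<open>\<rho> = R\<close>
(\<open>sphere_meets_interior\<close>). The proof goes around the cycle
(i) \<open>\<Rightarrow>\<close> (iii) \<open>\<Rightarrow>\<close> (v) \<open>\<Rightarrow>\<close> (iv) \<open>\<Rightarrow>\<close> (ii) \<open>\<Rightarrow>\<close> (i).

For (i) \<open>\<Rightarrow>\<close> (iii), directions that do not lead from \<open>c\<close> into \<open>K\<close> do not lead
into \<open>K\<close> from points near \<open>c\<close> either, so the remaining ones serve there
(\<open>translates_cover_if_directions\<close>).

The step (v) \<open>\<Rightarrow>\<close> (iv) is where the plane enters. A separation argument yields an
interior point \<open>c + y\<close> of \<open>K\<close> such that \<open>y\<close> makes no obtuse angle with any
\<open>x - c\<close>, \<open>x\<close> touching. If \<open>y \<noteq> 0\<close>, then \<open>x + t y\<close> leaves the circumball for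
every touching \<open>x\<close> and every \<open>t > 0\<close>, against (v); hence \<open>c\<close> is an interior point
(\<open>center_in_interior\<close>) and the translates cover a full ball around \<open>c\<close>. The touching
points may be infinite in number, and to pass to finitely many of them it is enough, by compactness
of the unit circle, to serve all directions near a given direction \<open>u\<close>. On each of the two
sides of \<open>u\<close> a single touching point does this (\<open>one_sided_neighborhood\<close>).

For (iv) \<open>\<Rightarrow>\<close> (ii), compactness of \<open>K \<times> [0, R]\<close> reduces the uniform bound to a
local question. The critical pairs are \<open>(x, 0)\<close>, where a chord into the interior gives one
direction for all small lengths, and \<open>(c, R)\<close>, where the translates in (iv), combined with an
interior point of \<open>K\<close>, give directions for all lengths slightly below \<open>R\<close>. For
(ii) \<open>\<Rightarrow>\<close> (i), equally many directions for lengths tending to \<open>R\<close> have a limit.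
\<close>

section \<open>Directions and the two covering numbers\<close>

lemma c_num_le_card:
  assumes "finite D" and "D \<subseteq> sphere 0 1"
    and "\<And>x. x \<in> K \<Longrightarrow> \<exists>r\<in>D. x + \<epsilon> *\<^sub>R r \<in> interior K"
  shows "c_num K \<epsilon> \<le> enat (card D)"
proof -
  obtain f where f: "bij_betw f {..<card D} D"
    using ex_bij_betw_nat_finite[OF \<open>finite D\<close>] atLeast0LessThan by metis
  then have D: "D = f ` {..<card D}" by (simp add: bij_betw_def)
  have "\<forall>i<card D. f i \<in> sphere 0 1"
    using D assms(2) by blast
  moreover have "\<forall>x\<in>K. \<exists>i<card D. x + \<epsilon> *\<^sub>R f i \<in> interior K"
    using D assms(3) by (metis imageE lessThan_iff)
  ultimately show ?thesis
    unfolding c_num_def by (intro Inf_lower) blast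
qed

text \<open>A bound on the number only provides at most \<open>m\<close> directions; the actual minimum \<open>k\<close>
depends on the length.\<close>

lemma c_num_leD:
  assumes "c_num K \<epsilon> \<le> enat m"
  obtains k r where "k \<le> m" and "\<And>i. i < k \<Longrightarrow> r i \<in> sphere 0 1"
    and "\<And>x. x \<in> K \<Longrightarrow> \<exists>i<k. x + \<epsilon> *\<^sub>R r i \<in> interior K"
proof -
  let ?S = "{enat m | m. \<exists>r :: nat \<Rightarrow> 'a. (\<forall>i<m. r i \<in> sphere 0 1) \<and>
     (\<forall>x\<in>K. \<exists>i<m. x + \<epsilon> *\<^sub>R r i \<in> interior K)}"
  have "?S \<noteq> {}"
  proof
    assume "?S = {}"
    then have "c_num K \<epsilon> = \<infinity>"
      unfolding c_num_def by (metis Inf_enat_def)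
    then show False using assms by simp
  qed
  then have "Inf ?S \<in> ?S" by (simp only: Inf_enat_def if_False) (meson LeastI ex_in_conv)
  then obtain k where k: "c_num K \<epsilon> = enat k" "\<exists>r :: nat \<Rightarrow> 'a. (\<forall>i<k. r i \<in> sphere 0 1) \<and>
     (\<forall>x\<in>K. \<exists>i<k. x + \<epsilon> *\<^sub>R r i \<in> interior K)"
    unfolding c_num_def by blast
  have "k \<le> m" using assms k(1) by simp
  with k(2) that show ?thesis by blast
qed

lemma i_num_finite_iff:
  "i_num K \<epsilon> < \<infinity> \<longleftrightarrow>
    (\<exists>D. finite D \<and> D \<subseteq> sphere 0 1 \<and> (\<forall>x\<in>K. \<exists>r\<in>D. x + \<epsilon> *\<^sub>R r \<in> K))"
proof
  assume fin: "i_num K \<epsilon> < \<infinity>"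
  obtain m and r :: "nat \<Rightarrow> 'a" where "\<forall>i<m. r i \<in> sphere 0 1" "\<forall>x\<in>K. \<exists>i<m. x + \<epsilon> *\<^sub>R r i \<in> K"
  proof -
    have "{enat m | m. \<exists>r :: nat \<Rightarrow> 'a. (\<forall>i<m. r i \<in> sphere 0 1) \<and>
      (\<forall>x\<in>K. \<exists>i<m. x + \<epsilon> *\<^sub>R r i \<in> K)} \<noteq> {}"
      using fin unfolding i_num_def by (metis Inf_enat_def order_less_irrefl)
    then show ?thesis using that by blast
  qed
  then have "finite (r ` {..<m}) \<and> r ` {..<m} \<subseteq> sphere 0 1 \<and>
      (\<forall>x\<in>K. \<exists>r\<in>r ` {..<m}. x + \<epsilon> *\<^sub>R r \<in> K)"
    by blast
  then show "\<exists>D. finite D \<and> D \<subseteq> sphere 0 1 \<and> (\<forall>x\<in>K. \<exists>r\<in>D. x + \<epsilon> *\<^sub>R r \<in> K)" by blast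
next
  assume "\<exists>D. finite D \<and> D \<subseteq> sphere 0 1 \<and> (\<forall>x\<in>K. \<exists>r\<in>D. x + \<epsilon> *\<^sub>R r \<in> K)"
  then obtain D where D: "finite D" "D \<subseteq> sphere 0 1" "\<forall>x\<in>K. \<exists>r\<in>D. x + \<epsilon> *\<^sub>R r \<in> K" by blast
  obtain f where "bij_betw f {..<card D} D"
    using ex_bij_betw_nat_finite[OF \<open>finite D\<close>] atLeast0LessThan by metis
  then have f: "D = f ` {..<card D}" by (simp add: bij_betw_def)
  have "\<forall>i<card D. f i \<in> sphere 0 1"
    using f D(2) by blast
  moreover have "\<forall>x\<in>K. \<exists>i<card D. x + \<epsilon> *\<^sub>R f i \<in> K"
    using f D(3) by (metis imageE lessThan_iff)
  ultimately have "i_num K \<epsilon> \<le> enat (card D)"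
    unfolding i_num_def by (intro Inf_lower) blast
  also have "\<dots> < \<infinity>" by simp
  finally show "i_num K \<epsilon> < \<infinity>" .
qed

text \<open>The dictionary between translates and displacements: \<open>z - c\<close> is the displacement of
the covered point from the center, and it has to carry \<open>x\<close> into \<open>K\<close>.\<close>

lemma mem_image_translate_iff:
  fixes c :: "'a::ab_group_add"
  shows "z \<in> (\<lambda>y. y + (c - x)) ` K \<longleftrightarrow> x + (z - c) \<in> K"
proof
  assume "x + (z - c) \<in> K"
  then show "z \<in> (\<lambda>y. y + (c - x)) ` K"
    by (rule rev_image_eqI) (simp add: algebra_simps)
qed (auto simp: algebra_simps)

section \<open>Convex bodies in their circumball\<close>

locale circumscribed_body =
  fixes K :: "'a::euclidean_space set" and c :: 'a and R :: real
  assumes body: "convex_body K" and circumball: "is_circumball K c R"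
begin

definition touching :: "'a set" where
  "touching = K \<inter> sphere c R"

lemma compact_K: "compact K" and convex_K: "convex K" and interior_K: "interior K \<noteq> {}"
  and K_nonempty: "K \<noteq> {}" and closed_K: "closed K"
  using body interior_subset compact_imp_closed unfolding convex_body_def by blast+

lemma closure_interior_K: "closure (interior K) = K"
  using convex_closure_interior[OF convex_K interior_K] closure_closed[OF closed_K] by simp

lemma norm_le_radius: "x \<in> K \<Longrightarrow> norm (x - c) \<le> R"
  using circumball unfolding is_circumball_def by (auto simp: dist_norm norm_minus_commute)

lemma touching_iff: "x \<in> touching \<longleftrightarrow> x \<in> K \<and> norm (x - c) = R"
  unfolding touching_def by (auto simp: dist_norm norm_minus_commute)

lemma compact_touching: "compact touching"
  unfolding touching_def by (intro compact_Int compact_K compact_sphere)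

lemma radius_pos: "0 < R"
proof (rule ccontr)
  assume "\<not> 0 < R"
  have "z = c" if "z \<in> cball c R" for z
  proof -
    have "dist c z \<le> 0" using that \<open>\<not> 0 < R\<close> unfolding mem_cball by linarith
    then show ?thesis by simp
  qed
  then have "cball c R \<subseteq> {c}" by blast
  then have "K \<subseteq> {c}" using circumball unfolding is_circumball_def by blast
  then have "interior K \<subseteq> interior {c}" by (rule interior_mono)
  then show False using interior_K by simp
qed

lemma interior_mix:
  assumes "a \<in> interior K" "b \<in> K" "0 < l" "l \<le> 1"
  shows "l *\<^sub>R a + (1 - l) *\<^sub>R b \<in> interior K"
  using mem_interior_convex_shrink[OF convex_K, of a b l] assms by (simp add: algebra_simps)

lemma shorten:
  assumes "x \<in> K" "x + s *\<^sub>R v \<in> K" "0 \<le> t" "t \<le> s"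
  shows "x + t *\<^sub>R v \<in> K"
proof (cases "s = 0")
  case False
  then have "(1 - t/s) *\<^sub>R x + (t/s) *\<^sub>R (x + s *\<^sub>R v) \<in> K"
    using assms by (intro convexD[OF convex_K]) (auto simp: field_simps)
  then show ?thesis using False by (simp add: algebra_simps)
qed (use assms in auto)

text \<open>Otherwise the point of \<open>K\<close> nearest to \<open>c\<close> would be at least as close to each point
of \<open>K\<close> as \<open>c\<close> is, hence the center of a second circumball.\<close>

lemma center_in_K: "c \<in> K"
proof (rule ccontr)
  assume "c \<notin> K"
  let ?p = "closest_point K c"
  have "dist ?p x \<le> R" if "x \<in> K" for x
  proof -
    have "(c - ?p) \<bullet> (x - ?p) \<le> 0"
      by (rule closest_point_dot[OF convex_K closed_K that])
    moreover have "0 \<le> (c - ?p) \<bullet> (c - ?p)" by simp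
    ultimately have "(x - ?p) \<bullet> (x - ?p) \<le> (x - c) \<bullet> (x - c)"
      by (simp add: inner_diff inner_commute)
    then have "norm (x - ?p) \<le> norm (x - c)" by (simp add: norm_le)
    then show ?thesis using norm_le_radius[OF that] by (simp add: dist_norm norm_minus_commute)
  qed
  then have "K \<subseteq> cball ?p R" by auto
  then have "is_circumball K ?p R" using circumball unfolding is_circumball_def by blast
  then have "?p = c" using circumball_unique[OF K_nonempty] circumball by blast
  then show False
    using \<open>c \<notin> K\<close> closest_point_in_set[OF closed_K K_nonempty] by metis
qed

text \<open>The interior of \<open>K\<close> is connected and meets the ball around \<open>x\<close>. If it missed the
sphere, the ball would contain all of it, so \<open>K\<close> would lie in a ball of radius \<open>\<rho>\<close>,
which only the circumball can be.\<close>

lemma sphere_meets_interior: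
  assumes "x \<in> K" "0 < \<rho>" "\<rho> \<le> R" "x \<noteq> c \<or> \<rho> < R"
  shows "\<exists>r\<in>sphere 0 1. x + \<rho> *\<^sub>R r \<in> interior K"
proof -
  have "interior K \<inter> ball x \<rho> \<noteq> {}"
  proof -
    have "x \<in> closure (interior K)" "x \<in> ball x \<rho>" using assms closure_interior_K by auto
    then show ?thesis using open_Int_closure_eq_empty[of "ball x \<rho>" "interior K"] by blast
  qed
  moreover have "interior K - ball x \<rho> \<noteq> {}"
  proof
    assume "interior K - ball x \<rho> = {}"
    then have "interior K \<subseteq> cball x \<rho>" using ball_subset_cball by blast
    then have sub: "K \<subseteq> cball x \<rho>"
      using closure_minimal[OF _ closed_cball] closure_interior_K by metis
    then have "R \<le> \<rho>" using circumball unfolding is_circumball_def by blast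
    then have "\<rho> = R" using assms by simp
    then have "is_circumball K x R" using sub circumball unfolding is_circumball_def by blast
    then have "x = c" using circumball_unique[OF K_nonempty] circumball by blast
    then show False using assms \<open>\<rho> = R\<close> by simp
  qed
  ultimately have "interior K \<inter> frontier (ball x \<rho>) \<noteq> {}"
    using connected_Int_frontier convex_connected[OF convex_interior[OF convex_K]] by blast
  moreover have "frontier (ball x \<rho>) = sphere x \<rho>" using \<open>0 < \<rho>\<close> by (rule frontier_ball)
  ultimately obtain y where y: "y \<in> interior K" "dist x y = \<rho>" by (metis disjoint_iff mem_sphere)
  let ?r = "(1/\<rho>) *\<^sub>R (y - x)"
  have "?r \<in> sphere 0 1" "x + \<rho> *\<^sub>R ?r = y"
    using y \<open>0 < \<rho>\<close> by (auto simp: dist_norm norm_minus_commute)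
  then show ?thesis using y by metis
qed

section \<open>From finitely many directions to finitely many translates\<close>

text \<open>The directions in \<open>D0\<close> lead from \<open>c\<close> out of the closed set \<open>K\<close>, so they still
do so from all points of a neighborhood \<open>V\<close> of \<open>c\<close>. There the other directions have to
do all the work, and these correspond to touching points.\<close>

lemma translates_cover_if_directions:
  assumes "finite D" "D \<subseteq> sphere 0 1" and D: "\<And>x. x \<in> K \<Longrightarrow> \<exists>r\<in>D. x + R *\<^sub>R r \<in> K"
  shows "\<exists>X \<delta>. finite X \<and> X \<subseteq> touching \<and> 0 < \<delta> \<and>
    (\<forall>z\<in>K \<inter> ball c \<delta>. \<exists>x\<in>X. x + (z - c) \<in> K)"
proof -
  define D0 where "D0 = {r\<in>D. c + R *\<^sub>R r \<notin> K}"
  define V where "V = (\<Inter>r\<in>D0. {x. x + R *\<^sub>R r \<in> - K})"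
  have "open V" unfolding V_def D0_def
    using \<open>finite D\<close> closed_K
    by (intro open_INT ballI open_vimage[of "- K" "\<lambda>x. x + R *\<^sub>R _", unfolded vimage_def])
      (auto intro!: continuous_intros)
  moreover have "c \<in> V" by (auto simp: V_def D0_def)
  ultimately obtain \<delta> where \<delta>: "0 < \<delta>" "ball c \<delta> \<subseteq> V" using open_contains_ball by blast
  define X where "X = (\<lambda>r. c + R *\<^sub>R r) ` (D - D0)"
  have "finite X" using \<open>finite D\<close> by (simp add: X_def)
  moreover have "X \<subseteq> touching"
    using assms(2) radius_pos by (fastforce simp: X_def D0_def touching_iff)
  moreover have "\<exists>x\<in>X. x + (z - c) \<in> K" if z: "z \<in> K \<inter> ball c \<delta>" for z
  proof -
    obtain r where r: "r \<in> D" "z + R *\<^sub>R r \<in> K" using D z by blast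
    have "z \<in> V" using z \<delta> by blast
    then have "r \<notin> D0" using r by (auto simp: V_def)
    then have "c + R *\<^sub>R r \<in> X" using r by (auto simp: X_def)
    then show ?thesis using r by (intro bexI[of _ "c + R *\<^sub>R r"]) (auto simp: algebra_simps)
  qed
  ultimately show ?thesis using \<delta>(1) by blast
qed

section \<open>The circumcenter is an interior point\<close>

text \<open>\<open>W\<close> is the cone dual to the directions \<open>x - c\<close> of the touching points. Were
it disjoint from the interior of \<open>K\<close> (seen from \<open>c\<close>), a separating normal \<open>m\<close> would be
nonnegative on \<open>K - c\<close>, thus belong to \<open>W\<close> itself, and be bounded above on the cone
\<open>W\<close>. But on the ray through \<open>m\<close> it is unbounded.\<close>

lemma interior_point_in_dual_cone:
  "\<exists>y. c + y \<in> interior K \<and> (\<forall>x\<in>touching. 0 \<le> (x - c) \<bullet> y)"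
proof (rule ccontr)
  assume none: "\<not> ?thesis"
  define W where "W = {y. \<forall>x\<in>touching. 0 \<le> (x - c) \<bullet> y}"
  define I where "I = (\<lambda>z. z - c) ` interior K"
  have "convex W"
    unfolding W_def convex_def by (auto simp: inner_add_right)
  moreover have "convex I"
    using convex_translation[OF convex_interior[OF convex_K], of "- c"] by (simp add: I_def image_def)
  moreover have "0 \<in> W" by (simp add: W_def)
  moreover have "I \<noteq> {}" using interior_K by (simp add: I_def)
  moreover have "W \<inter> I = {}"
  proof -
    have "z - c \<notin> W" if "z \<in> interior K" for z
      using none that by (auto simp: W_def dest: spec[of _ "z - c"])
    then show ?thesis by (auto simp: I_def)
  qed
  ultimately obtain m b where m: "m \<noteq> 0" "\<forall>w\<in>W. m \<bullet> w \<le> b" "\<forall>y\<in>I. b \<le> m \<bullet> y"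
    using separating_hyperplane_sets[of W I] by blast
  have "0 \<le> b" using m(2) \<open>0 \<in> W\<close> by force
  have "interior K \<subseteq> {z. b \<le> m \<bullet> (z - c)}" using m(3) by (auto simp: I_def)
  moreover have "closed {z. b \<le> m \<bullet> (z - c)}"
    by (intro closed_Collect_le continuous_intros)
  ultimately have "K \<subseteq> {z. b \<le> m \<bullet> (z - c)}"
    using closure_minimal closure_interior_K by metis
  then have "\<forall>x\<in>touching. 0 \<le> (x - c) \<bullet> m"
    using \<open>0 \<le> b\<close> by (fastforce simp: touching_iff inner_commute)
  \<comment> \<open>a point of \<open>W\<close> at which \<open>m\<close> takes the value \<open>b + 1\<close>\<close>
  then have "((b + 1) / (m \<bullet> m)) *\<^sub>R m \<in> W"
    using \<open>0 \<le> b\<close> by (auto simp: W_def)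
  then have "m \<bullet> (((b + 1) / (m \<bullet> m)) *\<^sub>R m) \<le> b" using m(2) by blast
  then show False using m(1) by simp
qed

text \<open>For \<open>y\<close> in the dual cone and touching \<open>x\<close>, moving \<open>x\<close> by \<open>t y\<close> increases
the distance from \<open>c\<close> beyond \<open>R\<close>. So the points \<open>c + t y\<close> of \<open>K\<close> are in no
translate, and the interior point found above can only be \<open>c\<close>.\<close>

lemma center_in_interior:
  assumes "0 < \<delta>" and cover: "\<And>z. z \<in> K \<inter> ball c \<delta> \<Longrightarrow> \<exists>x\<in>touching. x + (z - c) \<in> K"
  shows "c \<in> interior K"
proof -
  obtain y where y: "c + y \<in> interior K" and dual: "\<forall>x\<in>touching. 0 \<le> (x - c) \<bullet> y"
    using interior_point_in_dual_cone by blast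
  have "y = 0"
  proof (rule ccontr)
    assume "y \<noteq> 0"
    define t where "t = min 1 (\<delta> / (2 * norm y))"
    have t: "0 < t" "t \<le> 1" "t \<le> \<delta> / (2 * norm y)" using \<open>0 < \<delta>\<close> \<open>y \<noteq> 0\<close> by (auto simp: t_def)
    have "t * norm y \<le> \<delta> / 2" using t(3) \<open>y \<noteq> 0\<close> by (simp add: field_simps)
    then have "c + t *\<^sub>R y \<in> ball c \<delta>" using t \<open>0 < \<delta>\<close> by (simp add: dist_norm)
    moreover have "c + t *\<^sub>R y \<in> K"
      using shorten[OF center_in_K, of 1 y t] y interior_subset t by auto
    ultimately obtain x where x: "x \<in> touching" "x + t *\<^sub>R y \<in> K" using cover by force
    have "norm ((x - c) + t *\<^sub>R y) \<le> R" using norm_le_radius[OF x(2)] by (simp add: algebra_simps)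
    then have "(norm ((x - c) + t *\<^sub>R y))\<^sup>2 \<le> R\<^sup>2" by (intro power_mono) auto
    moreover have "(norm ((x - c) + t *\<^sub>R y))\<^sup>2 = R\<^sup>2 + 2 * t * ((x - c) \<bullet> y) + t\<^sup>2 * (norm y)\<^sup>2"
    proof -
      have "R\<^sup>2 = (x - c) \<bullet> (x - c)"
        using x(1) by (metis touching_iff power2_norm_eq_inner)
      then show ?thesis
        unfolding power2_norm_eq_inner by (simp add: inner_add inner_commute power2_eq_square)
    qed
    moreover have "0 \<le> 2 * t * ((x - c) \<bullet> y)" using dual x(1) t by simp
    moreover have "0 < t\<^sup>2 * (norm y)\<^sup>2" using t \<open>y \<noteq> 0\<close> by simp
    ultimately show False by linarith
  qed
  then show ?thesis using y by simp
qed

section \<open>Finitely many touching points suffice in the plane\<close>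

text \<open>
If some touching point sees the interior of \<open>K\<close> in direction \<open>u\<close>, it serves a full
neighborhood of \<open>u\<close>. Otherwise take touching points \<open>x k\<close> that serve the directions
\<open>u + n / (k + 1)\<close>, and let \<open>z\<close> be a limit of a subsequence. Since \<open>z + t u\<close> is in
\<open>K\<close>, the vector \<open>z - c\<close> has a negative component along \<open>u\<close>. Its component along
\<open>n\<close> must be negative as well:
\<^item> if it were zero, the ray from \<open>z\<close> in direction \<open>u\<close> would reach the interior point \<open>c\<close>;
\<^item> if it were positive, then for late \<open>k\<close> the ray from \<open>x k\<close> in direction \<open>u\<close> would have
\<open>c\<close> strictly on one side and the point \<open>x k + t (u + n / (k + 1))\<close> of \<open>K\<close> on the
other, and would cross the segment between them in an interior point of \<open>K\<close>.

So \<open>c\<close> lies on the \<open>n\<close>-side of the line through \<open>z\<close> along \<open>u\<close>, and the triangle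
with vertices \<open>z\<close>, \<open>z + t u\<close>, \<open>c\<close> shows that \<open>z\<close> serves all directions on the
\<open>n\<close>-side near \<open>u\<close>. The hypothesis on \<open>u\<close> and \<open>n\<close> makes them an orthonormal
basis, so the ambient space is a plane.
\<close>

lemma one_sided_neighborhood:
  assumes c: "c \<in> interior K"
    and "0 < e" and cover: "\<And>v. norm v < e \<Longrightarrow> \<exists>x\<in>touching. x + v \<in> K"
    and u: "norm u = 1" and n: "norm n = 1"
    and basis: "\<And>y. y = (y \<bullet> u) *\<^sub>R u + (y \<bullet> n) *\<^sub>R n"
  shows "\<exists>x\<in>touching. \<exists>s>0. \<exists>U. open U \<and> u \<in> U \<and> (\<forall>w\<in>U. 0 \<le> w \<bullet> n \<longrightarrow> x + s *\<^sub>R w \<in> K)"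
proof (cases "\<exists>x\<in>touching. \<exists>s>0. x + s *\<^sub>R u \<in> interior K")
  case True
  then obtain x s where xs: "x \<in> touching" "0 < s" "x + s *\<^sub>R u \<in> interior K" by blast
  have "open {w. x + s *\<^sub>R w \<in> interior K}"
    by (intro open_vimage[unfolded vimage_def] continuous_intros open_interior)
  then show ?thesis using xs interior_subset by fast
next
  case False
  have un: "u \<bullet> n = 0"
  proof -
    have "n \<bullet> u = (n \<bullet> u) * (u \<bullet> u) + (n \<bullet> n) * (n \<bullet> u)"
      by (subst basis[of n]) (simp add: inner_add_left)
    then show ?thesis using u n by (simp add: norm_eq_1 inner_commute)
  qed
  \<comment> \<open>the vectors \<open>u + n / (k + 1)\<close> have norm at most 2, so that \<open>t\<close> times them is shorter than \<open>e\<close>\<close>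
  define t where "t = e / 3"
  have "0 < t" using \<open>0 < e\<close> by (simp add: t_def)
  have "\<exists>x\<in>touching. x + t *\<^sub>R (u + (1 / real (Suc k)) *\<^sub>R n) \<in> K" for k
  proof -
    have "norm ((1 / real (Suc k)) *\<^sub>R n) \<le> 1" using n by simp
    then have "norm (u + (1 / real (Suc k)) *\<^sub>R n) \<le> 1 + 1"
      using norm_triangle_ineq[of u "(1 / real (Suc k)) *\<^sub>R n"] u by linarith
    then have "norm (t *\<^sub>R (u + (1 / real (Suc k)) *\<^sub>R n)) \<le> t * 2"
      using \<open>0 < t\<close> by simp
    then show ?thesis using cover \<open>0 < e\<close> by (simp add: t_def)
  qed
  then obtain x where xT: "\<And>k. x k \<in> touching"
    and xK: "\<And>k. x k + t *\<^sub>R (u + (1 / real (Suc k)) *\<^sub>R n) \<in> K" by metis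
  obtain z f where z: "z \<in> touching" and f: "strict_mono f" and lim: "(x \<circ> f) \<longlonglongrightarrow> z"
    using compact_touching xT unfolding compact_def by metis
  have "(\<lambda>k. 1 / real (Suc (f k))) \<longlonglongrightarrow> 0"
    using LIMSEQ_subseq_LIMSEQ[OF LIMSEQ_inverse_real_of_nat f]
    by (simp add: o_def inverse_eq_divide)
  then have "(\<lambda>k. (x \<circ> f) k + t *\<^sub>R (u + (1 / real (Suc (f k))) *\<^sub>R n)) \<longlonglongrightarrow> z + t *\<^sub>R (u + 0 *\<^sub>R n)"
    by (intro tendsto_intros lim)
  then have zK: "z + t *\<^sub>R u \<in> K"
    using closed_sequentially[OF closed_K] xK by fastforce
  define p where "p = (z - c) \<bullet> u"
  define q where "q = - ((z - c) \<bullet> n)"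
  have zc: "z - c = p *\<^sub>R u - q *\<^sub>R n" using basis[of "z - c"] by (simp add: p_def q_def)
  have "p < 0"
  proof -
    have "norm ((z - c) + t *\<^sub>R u) \<le> R" using norm_le_radius[OF zK] by (simp add: algebra_simps)
    then have "(norm ((z - c) + t *\<^sub>R u))\<^sup>2 \<le> R\<^sup>2" by (intro power_mono) auto
    moreover have "R\<^sup>2 = (z - c) \<bullet> (z - c)"
      using z by (metis touching_iff power2_norm_eq_inner)
    moreover have "(norm ((z - c) + t *\<^sub>R u))\<^sup>2 = (z - c) \<bullet> (z - c) + 2 * t * p + t\<^sup>2"
      using u unfolding power2_norm_eq_inner
      by (simp add: inner_add inner_commute power2_eq_square p_def norm_eq_1)
    ultimately have "2 * t * p + t\<^sup>2 \<le> 0" by linarith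
    moreover have "0 < t\<^sup>2" using \<open>0 < t\<close> by simp
    ultimately have "t * p < 0" by linarith
    then show ?thesis using \<open>0 < t\<close> by (simp add: mult_less_0_iff)
  qed
  have "q \<noteq> 0"
  proof
    assume "q = 0"
    then have "z + (- p) *\<^sub>R u = c" using zc by (simp add: algebra_simps)
    then show False using False z \<open>p < 0\<close> c by (metis neg_0_less_iff_less)
  qed
  moreover have "\<not> q < 0"
  proof
    assume "q < 0"
    have "\<forall>\<^sub>F k in sequentially. 0 < ((x \<circ> f) k - c) \<bullet> n"
    proof (rule order_tendstoD(1))
      show "(\<lambda>k. ((x \<circ> f) k - c) \<bullet> n) \<longlonglongrightarrow> (z - c) \<bullet> n" by (intro tendsto_intros lim)
    qed (use \<open>q < 0\<close> in \<open>simp add: q_def\<close>)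
    moreover have "\<forall>\<^sub>F k in sequentially. ((x \<circ> f) k - c) \<bullet> u < 0"
    proof (rule order_tendstoD(2))
      show "(\<lambda>k. ((x \<circ> f) k - c) \<bullet> u) \<longlonglongrightarrow> (z - c) \<bullet> u" by (intro tendsto_intros lim)
    qed (use \<open>p < 0\<close> in \<open>simp add: p_def\<close>)
    ultimately have "\<forall>\<^sub>F k in sequentially.
        0 < ((x \<circ> f) k - c) \<bullet> n \<and> ((x \<circ> f) k - c) \<bullet> u < 0"
      by (rule eventually_conj)
    then obtain k where "0 < ((x \<circ> f) k - c) \<bullet> n \<and> ((x \<circ> f) k - c) \<bullet> u < 0"
      using eventually_happens'[OF sequentially_bot] by blast
    then obtain j where j: "0 < (x j - c) \<bullet> n" "(x j - c) \<bullet> u < 0" by auto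
    define A where "A = (x j - c) \<bullet> u"
    define B where "B = (x j - c) \<bullet> n"
    define h where "h = t / real (Suc j)"
    have xj: "x j = c + A *\<^sub>R u + B *\<^sub>R n"
      using basis[of "x j - c"] by (simp add: A_def B_def algebra_simps)
    have "0 < h" "0 < B" "A < 0" using \<open>0 < t\<close> j by (auto simp: h_def A_def B_def)
    \<comment> \<open>the weight at which the segment from the point of \<open>K\<close> to \<open>c\<close> is as high, along \<open>n\<close>, as \<open>x j\<close>\<close>
    define l where "l = h / (B + h)"
    have l: "0 < l" "l < 1" "(1 - l) * (B + h) = B"
      using \<open>0 < h\<close> \<open>0 < B\<close> by (auto simp: l_def field_simps)
    define s where "s = (1 - l) * t - l * A"
    have "0 < s"
      using l \<open>0 < t\<close> \<open>A < 0\<close> mult_pos_neg[of l A] mult_pos_pos[of "1 - l" t]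
      unfolding s_def by linarith
    have "l *\<^sub>R c + (1 - l) *\<^sub>R (x j + t *\<^sub>R (u + (1 / real (Suc j)) *\<^sub>R n)) \<in> interior K"
      using interior_mix[OF c xK] l by simp
    also have "l *\<^sub>R c + (1 - l) *\<^sub>R (x j + t *\<^sub>R (u + (1 / real (Suc j)) *\<^sub>R n))
        = c + ((1 - l) * (A + t)) *\<^sub>R u + ((1 - l) * (B + h)) *\<^sub>R n"
      unfolding xj by (simp add: h_def algebra_simps)
    also have "\<dots> = x j + s *\<^sub>R u"
      unfolding l(3) xj s_def by (simp add: algebra_simps)
    finally show False using False xT \<open>0 < s\<close> by blast
  qed
  ultimately have "0 < q" by simp
  \<comment> \<open>the coordinates with respect to the sides \<open>u\<close> and \<open>c - z\<close> of the triangle\<close>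
  define a where "a w = w \<bullet> u + (w \<bullet> n) * p / q" for w
  define b where "b w = (w \<bullet> n) / q" for w
  have w_eq: "w = a w *\<^sub>R u + b w *\<^sub>R (c - z)" for w
  proof -
    have "c - z = q *\<^sub>R n - p *\<^sub>R u" using zc by (simp add: algebra_simps)
    then have "a w *\<^sub>R u + b w *\<^sub>R (c - z) = a w *\<^sub>R u + b w *\<^sub>R (q *\<^sub>R n - p *\<^sub>R u)"
      by simp
    also have "\<dots> = (a w - b w * p) *\<^sub>R u + (b w * q) *\<^sub>R n"
      by (simp add: algebra_simps)
    also have "\<dots> = (w \<bullet> u) *\<^sub>R u + (w \<bullet> n) *\<^sub>R n"
      using \<open>0 < q\<close> by (simp add: a_def b_def)
    finally show ?thesis using basis by simp
  qed
  define U where "U = {w. 0 < a w} \<inter> {w. a w / t + b w < 2 / t}"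
  have "open U"
    unfolding U_def a_def b_def using \<open>0 < q\<close> \<open>0 < t\<close>
    by (intro open_Int open_Collect_less continuous_intros) auto
  moreover have "u \<in> U"
    using u un \<open>0 < t\<close> by (simp add: U_def a_def b_def norm_eq_1 divide_strict_right_mono)
  moreover have "z + (t / 2) *\<^sub>R w \<in> K" if w: "w \<in> U" "0 \<le> w \<bullet> n" for w
  proof -
    \<comment> \<open>barycentric coordinates of \<open>z + (t / 2) w\<close> at \<open>z + t u\<close> and \<open>c\<close>\<close>
    define al where "al = a w / 2"
    define be where "be = t * b w / 2"
    have "0 \<le> al" "0 \<le> be"
      using w \<open>0 < q\<close> \<open>0 < t\<close> by (auto simp: U_def al_def be_def b_def)
    moreover have "al + be \<le> 1"
    proof -
      have "t * (a w / t + b w) \<le> t * (2 / t)"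
        using w \<open>0 < t\<close> by (intro mult_left_mono) (auto simp: U_def)
      then show ?thesis using \<open>0 < t\<close> by (simp add: al_def be_def distrib_left)
    qed
    ultimately have "(1 - al - be) *\<^sub>R z + al *\<^sub>R (z + t *\<^sub>R u) + be *\<^sub>R c \<in> convex hull {z, z + t *\<^sub>R u, c}"
      unfolding convex_hull_3 by force
    also have "\<dots> \<subseteq> K"
      using z zK center_in_K convex_K by (intro hull_minimal) (auto simp: touching_iff)
    finally have "(1 - al - be) *\<^sub>R z + al *\<^sub>R (z + t *\<^sub>R u) + be *\<^sub>R c \<in> K" .
    moreover have "z + (t / 2) *\<^sub>R w = z + (t / 2) *\<^sub>R (a w *\<^sub>R u + b w *\<^sub>R (c - z))"
      using w_eq by simp
    moreover have "z + (t / 2) *\<^sub>R (a w *\<^sub>R u + b w *\<^sub>R (c - z))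
        = (1 - al - be) *\<^sub>R z + al *\<^sub>R (z + t *\<^sub>R u) + be *\<^sub>R c"
      by (simp add: al_def be_def algebra_simps)
    ultimately show ?thesis by simp
  qed
  ultimately show ?thesis using z \<open>0 < t\<close> by (intro bexI[of _ z] exI[of _ "t/2"]) auto
qed

text \<open>The one-sided statement for \<open>n\<close> and \<open>- n\<close> gives two touching points that serve all
directions near \<open>u\<close> with a common length, and compactness of the unit sphere leaves finitely
many \<open>u\<close>. By convexity every shorter displacement in a served direction is served too.\<close>

lemma finite_translates_cover_ball:
  assumes "0 < \<delta>" and cover: "\<And>z. z \<in> K \<inter> ball c \<delta> \<Longrightarrow> \<exists>x\<in>touching. x + (z - c) \<in> K"
    and planar: "\<And>u :: 'a. norm u = 1 \<Longrightarrow> \<exists>n. norm n = 1 \<and> (\<forall>y. y = (y \<bullet> u) *\<^sub>R u + (y \<bullet> n) *\<^sub>R n)"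
  shows "\<exists>X \<epsilon>. finite X \<and> X \<subseteq> touching \<and> 0 < \<epsilon> \<and> (\<forall>z\<in>ball c \<epsilon>. \<exists>x\<in>X. x + (z - c) \<in> K)"
proof -
  have c: "c \<in> interior K" using center_in_interior[OF \<open>0 < \<delta>\<close> cover] .
  then obtain e0 where e0: "0 < e0" "ball c e0 \<subseteq> K" using mem_interior by blast
  define e where "e = min e0 \<delta>"
  have "0 < e" using e0 \<open>0 < \<delta>\<close> by (simp add: e_def)
  have cover': "\<exists>x\<in>touching. x + v \<in> K" if "norm v < e" for v
  proof -
    have "c + v \<in> K \<inter> ball c \<delta>" using that e0 by (auto simp: e_def dist_norm subset_iff)
    then show ?thesis using cover by force
  qed
  have local: "\<exists>X s U. finite X \<and> X \<subseteq> touching \<and> 0 < s \<and> open U \<and> u \<in> U \<and>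
      (\<forall>w\<in>U. \<exists>x\<in>X. x + s *\<^sub>R w \<in> K)" if "u \<in> sphere 0 1" for u
  proof -
    have u: "norm u = 1" using that by simp
    obtain n where n: "norm n = 1" "\<And>y. y = (y \<bullet> u) *\<^sub>R u + (y \<bullet> n) *\<^sub>R n"
      using planar[OF u] by blast
    obtain x1 s1 U1 where 1: "x1 \<in> touching" "0 < s1" "open U1" "u \<in> U1"
        "\<And>w. w \<in> U1 \<Longrightarrow> 0 \<le> w \<bullet> n \<Longrightarrow> x1 + s1 *\<^sub>R w \<in> K"
      using one_sided_neighborhood[OF c \<open>0 < e\<close> cover' u n] by blast
    have n': "norm (- n) = 1" "\<And>y. y = (y \<bullet> u) *\<^sub>R u + (y \<bullet> (- n)) *\<^sub>R (- n)"
      using n by simp_all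
    obtain x2 s2 U2 where 2: "x2 \<in> touching" "0 < s2" "open U2" "u \<in> U2"
        "\<And>w. w \<in> U2 \<Longrightarrow> 0 \<le> w \<bullet> (- n) \<Longrightarrow> x2 + s2 *\<^sub>R w \<in> K"
      using one_sided_neighborhood[OF c \<open>0 < e\<close> cover' u n'] by blast
    have "\<exists>x\<in>{x1, x2}. x + min s1 s2 *\<^sub>R w \<in> K" if "w \<in> U1 \<inter> U2" for w
    proof (cases "0 \<le> w \<bullet> n")
      case True
      then show ?thesis
        using shorten[of x1 s1 w "min s1 s2"] 1 2 that by (auto simp: touching_iff)
    next
      case False
      then show ?thesis
        using shorten[of x2 s2 w "min s1 s2"] 1 2 that by (auto simp: touching_iff)
    qed
    moreover have "finite {x1, x2}" "{x1, x2} \<subseteq> touching" "0 < min s1 s2" "open (U1 \<inter> U2)" "u \<in> U1 \<inter> U2"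
      using 1 2 by auto
    ultimately show ?thesis by blast
  qed
  obtain X s U where loc: "\<And>u. u \<in> sphere 0 1 \<Longrightarrow> finite (X u) \<and> X u \<subseteq> touching \<and> 0 < s u \<and>
      open (U u) \<and> u \<in> U u \<and> (\<forall>w\<in>U u. \<exists>x\<in>X u. x + s u *\<^sub>R w \<in> K)"
    using local by metis
  have "sphere 0 1 \<subseteq> (\<Union>u\<in>sphere 0 1. U u)" using loc by blast
  then obtain C where C: "C \<subseteq> sphere 0 1" "finite C" "sphere 0 1 \<subseteq> (\<Union>u\<in>C. U u)"
    using compactE_image[OF compact_sphere, of "sphere 0 1" U 0 1] loc by blast
  have "C \<noteq> {}"
    using C(3) vector_choose_size[of 1] by force
  define \<epsilon> where "\<epsilon> = Min (s ` C)"
  have \<epsilon>: "0 < \<epsilon>" "\<And>u. u \<in> C \<Longrightarrow> \<epsilon> \<le> s u"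
    using C loc \<open>C \<noteq> {}\<close> by (auto simp: \<epsilon>_def)
  have "\<exists>x\<in>\<Union>(X ` C). x + (z - c) \<in> K" if "z \<in> ball c \<epsilon>" for z
  proof -
    obtain w where w: "norm w = 1" "z - c = norm (z - c) *\<^sub>R w"
    proof (cases "z = c")
      case True
      then show ?thesis using that vector_choose_size[of 1] by auto
    next
      case False
      then show ?thesis using that[of "(1 / norm (z - c)) *\<^sub>R (z - c)"] by simp
    qed
    then obtain u where u: "u \<in> C" "w \<in> U u" using C(3) by (metis UN_E mem_sphere_0 subsetD)
    then obtain x where x: "x \<in> X u" "x + s u *\<^sub>R w \<in> K" using loc C(1) by blast
    have "u \<in> sphere 0 1" using u C(1) by blast
    then have "x \<in> K" using loc[of u] x(1) by (auto simp: touching_iff)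
    moreover have "norm (z - c) \<le> s u"
      using that \<epsilon>(2)[OF u(1)] by (simp add: dist_norm norm_minus_commute)
    ultimately have "x + norm (z - c) *\<^sub>R w \<in> K" using shorten x(2) by simp
    then show ?thesis using w(2) x(1) u(1) by auto
  qed
  moreover have "finite (\<Union>(X ` C))" "\<Union>(X ` C) \<subseteq> touching" using C loc by blast+
  ultimately show ?thesis using \<epsilon>(1) by blast
qed

section \<open>Uniformly many directions for all shorter lengths\<close>

text \<open>By convexity, a direction that leads from \<open>x\<close> into the interior at length \<open>R / 2\<close> does
so at every shorter positive length, and the former is an open condition on \<open>x\<close>.\<close>

lemma local_directions_at_zero:
  assumes "x0 \<in> K"
  shows "\<exists>D U. finite D \<and> D \<subseteq> sphere 0 1 \<and> open U \<and> (x0, 0) \<in> U \<and>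
    (\<forall>(x, \<rho>)\<in>U. x \<in> K \<longrightarrow> 0 < \<rho> \<longrightarrow> \<rho> < R \<longrightarrow> (\<exists>r\<in>D. x + \<rho> *\<^sub>R r \<in> interior K))"
proof -
  obtain r where r: "r \<in> sphere 0 1" "x0 + (R/2) *\<^sub>R r \<in> interior K"
    using sphere_meets_interior[OF assms, of "R/2"] radius_pos by auto
  define U where "U = {x. x + (R/2) *\<^sub>R r \<in> interior K} \<times> {..<R/2}"
  have "open U"
    unfolding U_def
    by (intro open_Times open_vimage[unfolded vimage_def] continuous_intros open_interior open_lessThan)
  have step: "x + \<rho> *\<^sub>R r \<in> interior K" if "(x, \<rho>) \<in> U" "x \<in> K" "0 < \<rho>" for x \<rho>
  proof -
    define l where "l = 2 * \<rho> / R"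
    have "l *\<^sub>R (x + (R/2) *\<^sub>R r) + (1 - l) *\<^sub>R x \<in> interior K"
      using that radius_pos by (intro interior_mix) (auto simp: U_def l_def field_simps)
    moreover have "l *\<^sub>R (x + (R/2) *\<^sub>R r) + (1 - l) *\<^sub>R x = x + \<rho> *\<^sub>R r"
      using radius_pos by (simp add: l_def algebra_simps)
    ultimately show ?thesis by simp
  qed
  have "\<forall>(x, \<rho>)\<in>U. x \<in> K \<longrightarrow> 0 < \<rho> \<longrightarrow> \<rho> < R \<longrightarrow> (\<exists>r\<in>{r}. x + \<rho> *\<^sub>R r \<in> interior K)"
    using step by blast
  moreover note \<open>open U\<close>
  moreover have "finite {r}" "{r} \<subseteq> sphere 0 1" "(x0, 0) \<in> U"
    using r radius_pos by (auto simp: U_def)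
  ultimately show ?thesis by blast
qed

text \<open>With \<open>l = \<rho> / R < 1\<close> and an interior point \<open>p\<close>, a touching point \<open>y\<close>
satisfies \<open>x + l (y - c) = (1 - l) p + l (y + v)\<close> for a vector \<open>v\<close> that tends to \<open>0\<close> as
\<open>(x, \<rho>)\<close> tends to \<open>(c, R)\<close>. The covering supplies \<open>y\<close> with \<open>y + v \<in> K\<close>, and mixing
in \<open>p\<close> makes the point interior. The set \<open>U\<close> is the condition \<open>norm v < \<delta>\<close> with the
denominators cleared, which keeps it visibly open.\<close>

lemma local_directions_at_center:
  assumes "finite X" "X \<subseteq> touching" "0 < \<delta>"
    and cover: "\<And>z. z \<in> ball c \<delta> \<Longrightarrow> \<exists>x\<in>X. x + (z - c) \<in> K"
  shows "\<exists>D U. finite D \<and> D \<subseteq> sphere 0 1 \<and> open U \<and> (c, R) \<in> U \<and>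
    (\<forall>(x, \<rho>)\<in>U. x \<in> K \<longrightarrow> 0 < \<rho> \<longrightarrow> \<rho> < R \<longrightarrow> (\<exists>r\<in>D. x + \<rho> *\<^sub>R r \<in> interior K))"
proof -
  obtain p where p: "p \<in> interior K" using interior_K by blast
  define D where "D = (\<lambda>x. (1/R) *\<^sub>R (x - c)) ` X"
  define U where "U = {(x, \<rho>). norm (R *\<^sub>R (x - c) - (R - \<rho>) *\<^sub>R (p - c)) < \<rho> * \<delta>}"
  have "open U"
    unfolding U_def case_prod_beta by (intro open_Collect_less continuous_intros)
  moreover have "(c, R) \<in> U" using \<open>0 < \<delta>\<close> radius_pos by (simp add: U_def)
  moreover have "finite D" using \<open>finite X\<close> by (simp add: D_def)
  moreover have "D \<subseteq> sphere 0 1"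
    using \<open>X \<subseteq> touching\<close> radius_pos by (auto simp: D_def touching_iff)
  moreover have "\<exists>r\<in>D. x + \<rho> *\<^sub>R r \<in> interior K" if U: "(x, \<rho>) \<in> U" and "0 < \<rho>" "\<rho> < R" for x \<rho>
  proof -
    define l where "l = \<rho> / R"
    have l: "0 < l" "l < 1" "\<rho> = l * R" using that radius_pos by (auto simp: l_def)
    define v where "v = (1/l) *\<^sub>R ((x - c) - (1 - l) *\<^sub>R (p - c))"
    have "R *\<^sub>R (x - c) - (R - \<rho>) *\<^sub>R (p - c) = \<rho> *\<^sub>R v"
      using l radius_pos by (simp add: v_def algebra_simps)
    then have "norm (\<rho> *\<^sub>R v) < \<rho> * \<delta>" using U by (simp add: U_def)
    then have "norm v < \<delta>" using \<open>0 < \<rho>\<close> by simp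
    then have "c + v \<in> ball c \<delta>" by (simp add: dist_norm)
    then obtain y where y: "y \<in> X" "y + v \<in> K" using cover by force
    have "(1 - l) *\<^sub>R p + (1 - (1 - l)) *\<^sub>R (y + v) \<in> interior K"
      using interior_mix[OF p y(2), of "1 - l"] l by simp
    moreover have "(1 - l) *\<^sub>R p + (1 - (1 - l)) *\<^sub>R (y + v) = x + l *\<^sub>R (y - c)"
      using l by (simp add: v_def algebra_simps)
    moreover have "l *\<^sub>R (y - c) = \<rho> *\<^sub>R ((1/R) *\<^sub>R (y - c))" by (simp add: l_def)
    ultimately have "x + \<rho> *\<^sub>R ((1/R) *\<^sub>R (y - c)) \<in> interior K" by simp
    then show ?thesis using y(1) by (auto simp: D_def)
  qed
  then have "\<forall>(x, \<rho>)\<in>U. x \<in> K \<longrightarrow> 0 < \<rho> \<longrightarrow> \<rho> < R \<longrightarrow> (\<exists>r\<in>D. x + \<rho> *\<^sub>R r \<in> interior K)"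
    by blast
  ultimately show ?thesis by (intro exI[of _ D] exI[of _ U] conjI)
qed

lemma uniform_directions:
  assumes "finite X" "X \<subseteq> touching" "0 < \<delta>"
    and cover: "\<And>z. z \<in> ball c \<delta> \<Longrightarrow> \<exists>x\<in>X. x + (z - c) \<in> K"
  shows "\<exists>D. finite D \<and> D \<subseteq> sphere 0 1 \<and>
    (\<forall>\<rho> x. 0 < \<rho> \<longrightarrow> \<rho> < R \<longrightarrow> x \<in> K \<longrightarrow> (\<exists>r\<in>D. x + \<rho> *\<^sub>R r \<in> interior K))"
proof -
  define P where "P D U \<longleftrightarrow> finite D \<and> D \<subseteq> sphere 0 1 \<and> open U \<and>
    (\<forall>(x, \<rho>)\<in>U. x \<in> K \<longrightarrow> 0 < \<rho> \<longrightarrow> \<rho> < R \<longrightarrow> (\<exists>r\<in>D. x + \<rho> *\<^sub>R r \<in> interior K))"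
    for D :: "'a set" and U :: "('a \<times> real) set"
  have "\<exists>D U. P D U \<and> a \<in> U" if a: "a \<in> K \<times> {0..R}" for a
  proof -
    obtain x0 \<rho>0 where a': "a = (x0, \<rho>0)" "x0 \<in> K" "0 \<le> \<rho>0" "\<rho>0 \<le> R" using a by auto
    consider "\<rho>0 = 0" | "x0 = c" "\<rho>0 = R" | "0 < \<rho>0" "x0 \<noteq> c \<or> \<rho>0 < R" using a' by fastforce
    then show ?thesis
    proof cases
      case 1
      then show ?thesis using local_directions_at_zero[OF a'(2)] a' unfolding P_def by blast
    next
      case 2
      then show ?thesis using local_directions_at_center[OF assms] a' unfolding P_def by blast
    next
      case 3
      then obtain r where r: "r \<in> sphere 0 1" "x0 + \<rho>0 *\<^sub>R r \<in> interior K"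
        using sphere_meets_interior a' by blast
      let ?U = "{a. fst a + snd a *\<^sub>R r \<in> interior K}"
      have "open ?U"
        by (intro open_vimage[unfolded vimage_def] continuous_intros open_interior)
      then have "P {r} ?U" using r(1) by (auto simp: P_def)
      moreover have "a \<in> ?U" using r(2) a' by simp
      ultimately show ?thesis by blast
    qed
  qed
  then obtain D U where DU: "\<And>a. a \<in> K \<times> {0..R} \<Longrightarrow> P (D a) (U a) \<and> a \<in> U a" by metis
  obtain C where C: "C \<subseteq> K \<times> {0..R}" "finite C" "K \<times> {0..R} \<subseteq> (\<Union>a\<in>C. U a)"
  proof (rule compactE_image)
    show "compact (K \<times> {0..R})" using compact_K by (intro compact_Times) auto
    show "open (U a)" if "a \<in> K \<times> {0..R}" for a using DU[OF that] by (simp add: P_def)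
    show "K \<times> {0..R} \<subseteq> (\<Union>a\<in>K \<times> {0..R}. U a)" using DU by blast
  qed
  have "\<exists>r\<in>\<Union>(D ` C). x + \<rho> *\<^sub>R r \<in> interior K" if "0 < \<rho>" "\<rho> < R" "x \<in> K" for \<rho> x
  proof -
    have "(x, \<rho>) \<in> K \<times> {0..R}" using that by simp
    then obtain a where "a \<in> C" "(x, \<rho>) \<in> U a" using C(3) by blast
    then have "\<exists>r\<in>D a. x + \<rho> *\<^sub>R r \<in> interior K"
      using DU[of a] C(1) that unfolding P_def by blast
    then show ?thesis using \<open>a \<in> C\<close> by blast
  qed
  moreover have "finite (\<Union>(D ` C))" "\<Union>(D ` C) \<subseteq> sphere 0 1"
    using DU C(1,2) unfolding P_def by blast+
  ultimately show ?thesis by (intro exI[of _ "\<Union>(D ` C)"]) blast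
qed

lemma c_num_bounded:
  assumes "finite X" "X \<subseteq> touching" "0 < \<delta>"
    and "\<And>z. z \<in> ball c \<delta> \<Longrightarrow> \<exists>x\<in>X. x + (z - c) \<in> K"
  shows "(SUP \<rho>\<in>{0<..<R}. c_num K \<rho>) < \<infinity>"
proof -
  have "\<exists>D. finite D \<and> D \<subseteq> sphere 0 1 \<and>
      (\<forall>\<rho> x. 0 < \<rho> \<longrightarrow> \<rho> < R \<longrightarrow> x \<in> K \<longrightarrow> (\<exists>r\<in>D. x + \<rho> *\<^sub>R r \<in> interior K))"
    by (rule uniform_directions[OF assms(1-3)]) (rule assms(4))
  then obtain D where D: "finite D" "D \<subseteq> sphere 0 1"
    "\<forall>\<rho> x. 0 < \<rho> \<longrightarrow> \<rho> < R \<longrightarrow> x \<in> K \<longrightarrow> (\<exists>r\<in>D. x + \<rho> *\<^sub>R r \<in> interior K)"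
    by (elim exE conjE) (rule that)
  have "c_num K \<rho> \<le> enat (card D)" if "\<rho> \<in> {0<..<R}" for \<rho>
    using that D(3) by (intro c_num_le_card[OF D(1,2)]) simp
  then have "(SUP \<rho>\<in>{0<..<R}. c_num K \<rho>) \<le> enat (card D)" by (rule SUP_least)
  also have "\<dots> < \<infinity>" by simp
  finally show ?thesis .
qed

section \<open>Passing to the limit length\<close>

text \<open>After padding, the directions for the lengths \<open>\<rho> n\<close> are points of a countable product of
spheres, which is compact; let \<open>l\<close> be the limit of a subsequence. A point from which no
direction \<open>l i\<close>, \<open>i < m\<close>, led into the closed set \<open>K\<close> at length \<open>R\<close> would contradict
the choice of the directions for a late \<open>n\<close>.\<close>

lemma directions_if_c_num_bounded:
  assumes "(SUP \<rho>\<in>{0<..<R}. c_num K \<rho>) < \<infinity>"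
  shows "\<exists>D. finite D \<and> D \<subseteq> sphere 0 1 \<and> (\<forall>x\<in>K. \<exists>r\<in>D. x + R *\<^sub>R r \<in> K)"
proof -
  obtain m where m: "(SUP \<rho>\<in>{0<..<R}. c_num K \<rho>) = enat m" using assms by auto
  define S :: "(nat \<Rightarrow> 'a) set" where "S = UNIV \<rightarrow>\<^sub>E sphere 0 1"
  \<comment> \<open>the double successor keeps \<open>\<rho> 0\<close> positive\<close>
  define \<rho> where "\<rho> n = R - R * inverse (real (Suc (Suc n)))" for n
  have \<rho>: "0 < \<rho> n" "\<rho> n < R" for n
    using radius_pos by (auto simp: \<rho>_def field_simps intro!: add_pos_nonneg)
  have "(\<lambda>n. R - R * inverse (real (Suc (Suc n)))) \<longlonglongrightarrow> R - R * 0"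
    by (intro tendsto_intros LIMSEQ_Suc[OF LIMSEQ_inverse_real_of_nat])
  then have \<rho>_lim: "\<rho> \<longlonglongrightarrow> R" by (simp add: \<rho>_def[abs_def])
  have "\<exists>r\<in>S. \<forall>x\<in>K. \<exists>i<m. x + \<rho> n *\<^sub>R r i \<in> K" for n
  proof -
    have "c_num K (\<rho> n) \<le> enat m"
      using \<rho>[of n] m by (metis SUP_upper greaterThanLessThan_iff)
    then obtain k r where kr: "k \<le> m" "\<And>i. i < k \<Longrightarrow> r i \<in> sphere 0 1"
        "\<And>x. x \<in> K \<Longrightarrow> \<exists>i<k. x + \<rho> n *\<^sub>R r i \<in> interior K"
      by (rule c_num_leD) blast
    \<comment> \<open>as \<open>0 < k\<close>, repeating \<open>r 0\<close> pads the directions with unit vectors\<close>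
    then have "0 < k" using K_nonempty by fastforce
    let ?r = "\<lambda>i. if i < k then r i else r 0"
    have "?r \<in> S" using kr(2) \<open>0 < k\<close> by (auto simp: S_def)
    moreover have "\<exists>i<m. x + \<rho> n *\<^sub>R ?r i \<in> K" if x: "x \<in> K" for x
    proof -
      obtain i where "i < k" "x + \<rho> n *\<^sub>R r i \<in> interior K" using kr(3)[OF x] by blast
      then show ?thesis using kr(1) interior_subset by (intro exI[of _ i]) auto
    qed
    ultimately show ?thesis by (intro bexI[of _ ?r] ballI)
  qed
  then obtain r where r: "\<And>n. r n \<in> S" "\<And>n x. x \<in> K \<Longrightarrow> \<exists>i<m. x + \<rho> n *\<^sub>R r n i \<in> K" by metis
  have "compact S"
    unfolding S_def compactin_euclidean_iff[symmetric] euclidean_product_topology[symmetric]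
    by (simp add: compactin_PiE)
  then obtain l f where l: "l \<in> S" and f: "strict_mono f" and lim: "(r \<circ> f) \<longlonglongrightarrow> l"
    using r(1) unfolding compact_def by metis
  have lim_i: "(\<lambda>n. r (f n) i) \<longlonglongrightarrow> l i" for i
    using continuous_on_tendsto_compose[OF continuous_on_product_coordinates[of i] lim] by (simp add: o_def)
  have "\<exists>i<m. x + R *\<^sub>R l i \<in> K" if "x \<in> K" for x
  proof (rule ccontr)
    assume none: "\<not> (\<exists>i<m. x + R *\<^sub>R l i \<in> K)"
    have "\<forall>i\<in>{..<m}. \<forall>\<^sub>F n in sequentially. x + \<rho> (f n) *\<^sub>R r (f n) i \<in> - K"
    proof
      fix i assume "i \<in> {..<m}"
      have "(\<lambda>n. x + \<rho> (f n) *\<^sub>R r (f n) i) \<longlonglongrightarrow> x + R *\<^sub>R l i"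
        using LIMSEQ_subseq_LIMSEQ[OF \<rho>_lim f] by (intro tendsto_intros lim_i) (simp add: o_def)
      moreover have "x + R *\<^sub>R l i \<in> - K" using none \<open>i \<in> {..<m}\<close> by blast
      ultimately show "\<forall>\<^sub>F n in sequentially. x + \<rho> (f n) *\<^sub>R r (f n) i \<in> - K"
        using closed_K by (intro topological_tendstoD) auto
    qed
    then have "\<forall>\<^sub>F n in sequentially. \<forall>i\<in>{..<m}. x + \<rho> (f n) *\<^sub>R r (f n) i \<in> - K"
      by (intro eventually_ball_finite) auto
    then obtain n where "\<forall>i\<in>{..<m}. x + \<rho> (f n) *\<^sub>R r (f n) i \<in> - K"
      using eventually_happens'[OF sequentially_bot] by blast
    then show False using r(2)[OF that] by blast
  qed
  then have "finite (l ` {..<m}) \<and> l ` {..<m} \<subseteq> sphere 0 1 \<and> (\<forall>x\<in>K. \<exists>r\<in>l ` {..<m}. x + R *\<^sub>R r \<in> K)"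
    using l by (auto simp: S_def PiE_def)
  then show ?thesis by blast
qed

end

section \<open>The equivalence in the plane\<close>

lemma plane_orthonormal_complement:
  fixes u :: "real^2"
  assumes "norm u = 1"
  shows "\<exists>n. norm n = 1 \<and> (\<forall>y. y = (y \<bullet> u) *\<^sub>R u + (y \<bullet> n) *\<^sub>R n)"
proof (intro exI conjI allI)
  let ?n = "vector [- (u $ 2), u $ 1] :: real^2"
  have u: "u $ 1 * u $ 1 + u $ 2 * u $ 2 = 1"
    using assms by (simp add: norm_eq_1 inner_vec_def sum_2)
  then show "norm ?n = 1"
    by (simp add: norm_eq_1 inner_vec_def sum_2)
  fix y
  have "(y \<bullet> u) * u $ 1 + (y \<bullet> ?n) * ?n $ 1 = y $ 1 * (u $ 1 * u $ 1 + u $ 2 * u $ 2)"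
    "(y \<bullet> u) * u $ 2 + (y \<bullet> ?n) * ?n $ 2 = y $ 2 * (u $ 1 * u $ 1 + u $ 2 * u $ 2)"
    by (simp_all add: inner_vec_def sum_2 algebra_simps)
  then show "y = (y \<bullet> u) *\<^sub>R u + (y \<bullet> ?n) *\<^sub>R ?n"
    unfolding u by (simp add: vec_eq_iff forall_2)
qed

theorem theorem5p2:
  fixes K :: "(real^2) set"
  assumes "convex_body K"
  shows
    "(i_num K (circumradius K) < \<infinity>
        \<longleftrightarrow> (SUP \<rho>\<in>{0<..<circumradius K}. c_num K \<rho>) < \<infinity>) \<and>
     (i_num K (circumradius K) < \<infinity>
        \<longleftrightarrow> (\<exists>X \<delta>. finite X \<and> X \<subseteq> K \<inter> frontier (cball (circumcenter K) (circumradius K)) \<and> \<delta> > 0 \<and>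
              K \<inter> ball (circumcenter K) \<delta> \<subseteq> (\<Union>x\<in>X. (\<lambda>y. y + (circumcenter K - x)) ` K))) \<and>
     (i_num K (circumradius K) < \<infinity>
        \<longleftrightarrow> (\<exists>X \<delta>. finite X \<and> X \<subseteq> K \<inter> frontier (cball (circumcenter K) (circumradius K)) \<and> \<delta> > 0 \<and>
              ball (circumcenter K) \<delta> \<subseteq> (\<Union>x\<in>X. (\<lambda>y. y + (circumcenter K - x)) ` K))) \<and>
     (i_num K (circumradius K) < \<infinity>
        \<longleftrightarrow> (\<exists>\<delta>>0. K \<inter> ball (circumcenter K) \<delta> \<subseteq>
              (\<Union>x\<in>K \<inter> frontier (cball (circumcenter K) (circumradius K)).
                 (\<lambda>y. y + (circumcenter K - x)) ` K)))"
proof -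
  let ?c = "circumcenter K" and ?R = "circumradius K"
  let ?T = "K \<inter> frontier (cball ?c ?R)"
  let ?i = "i_num K ?R < \<infinity>"
  let ?ii = "(SUP \<rho>\<in>{0<..<?R}. c_num K \<rho>) < \<infinity>"
  let ?iii = "\<exists>X \<delta>. finite X \<and> X \<subseteq> ?T \<and> \<delta> > 0 \<and> K \<inter> ball ?c \<delta> \<subseteq> (\<Union>x\<in>X. (\<lambda>y. y + (?c - x)) ` K)"
  let ?iv = "\<exists>X \<delta>. finite X \<and> X \<subseteq> ?T \<and> \<delta> > 0 \<and> ball ?c \<delta> \<subseteq> (\<Union>x\<in>X. (\<lambda>y. y + (?c - x)) ` K)"
  let ?v = "\<exists>\<delta>>0. K \<inter> ball ?c \<delta> \<subseteq> (\<Union>x\<in>?T. (\<lambda>y. y + (?c - x)) ` K)"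
  have "compact K" "K \<noteq> {}"
    using assms interior_subset unfolding convex_body_def by blast+
  then interpret circumscribed_body K ?c ?R
    by unfold_locales (use assms is_circumball_circumcenter in auto)
  have T: "?T = touching" by (simp add: touching_def)
  have translates: "A \<subseteq> (\<Union>x\<in>Y. (\<lambda>y. y + (?c - x)) ` K) \<longleftrightarrow> (\<forall>z\<in>A. \<exists>x\<in>Y. x + (z - ?c) \<in> K)"
    for A Y :: "(real^2) set"
    by (simp only: subset_iff UN_iff mem_image_translate_iff Ball_def)
  have 13: "?iii" if i: "?i"
  proof -
    obtain D where "finite D" "D \<subseteq> sphere 0 1" "\<forall>x\<in>K. \<exists>r\<in>D. x + ?R *\<^sub>R r \<in> K"
      using i unfolding i_num_finite_iff by (elim exE conjE) (rule that)
    then show ?thesis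
      unfolding T translates by (intro translates_cover_if_directions) auto
  qed
  have 35: "?v" if "?iii"
    using that unfolding T translates by (elim exE conjE) (meson subsetD)
  have 54: "?iv" if v: "?v"
  proof -
    obtain \<delta> where "0 < \<delta>" "\<forall>z\<in>K \<inter> ball ?c \<delta>. \<exists>x\<in>touching. x + (z - ?c) \<in> K"
      using v unfolding T translates by (elim exE conjE) (rule that)
    then show ?thesis
      unfolding T translates
      by (intro finite_translates_cover_ball[of \<delta>] plane_orthonormal_complement) blast+
  qed
  have 42: "?ii" if iv: "?iv"
  proof -
    obtain X \<delta> where "finite X" "X \<subseteq> touching" "0 < \<delta>" "\<forall>z\<in>ball ?c \<delta>. \<exists>x\<in>X. x + (z - ?c) \<in> K"
      using iv unfolding T translates by (elim exE conjE) (rule that)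
    then show ?thesis by (intro c_num_bounded[of X \<delta>]) blast+
  qed
  have 21: "?i" if "?ii"
    using directions_if_c_num_bounded[OF that] unfolding i_num_finite_iff .
  show ?thesis using 13 35 54 42 21 by argo
qed

end
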